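(* (A) For any Boolean group $(G,+)$, the pair $(G,+)$ (where the group operation $+$ is naturally treated as a function of $G\times G$ into $G$) is an absolutely homogeneous GEC with the following property: $$(\ast)\quad\text{all the edges emanating from a single vertex have different colors.}$$ Moreover, the automorphism group of the GEC $(G,+)$ consists precisely of all translations of this group. In particular, each partial morphism of $(G,+)$ (into itself) defined on a non-empty sub-GEC of $(G,+)$ admits a unique extension to an automorphism of this GEC. (B) Two Boolean groups are structurally equivalent as GECs if and only if they are isomorphic as groups. Moreover, structural isotopies between them are precisely group isomorphisms. (C) Every non-empty GEC with the property that each its partial morphism (into itself, defined on a non-empty sub-GEC) admits a unique extension to an automorphism is isomorphic (as a GEC) to a Boolean group. (D) Every non-empty absolutely homogeneous GEC with property $(\ast)$ is isomorphic (as a GEC) to a Boolean group.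
   Context: A GEC (full graph with edge-coloring) is a pair $\mathfrak{G}=(V,\kappa)$ where $V$ is a set of vertices and $\kappa\colon V\times V\to Y$ is a surjection onto some set $Y$ such that for all $x,y,z\in V$: $\kappa(x,y)=\kappa(z,z)\iff x=y$; and $\kappa(y,x)=\kappa(x,y)$. For $x\neq y$, $\kappa(x,y)$ is the color of the edge $\{x,y\}$; the set $\mathrm{Col}(\mathfrak G)=\{\kappa(x,y): x\neq y\}$ is the palette; the common value $\kappa(z,z)$ is the pseudocolor. A sub-GEC is a GEC $(A,\kappa\restriction_{A\times A})$ with $A\subset V$. A partial morphism from $(V,\kappa)$ into $(W,\lambda)$ is a function $f\colon A\to W$ with $A\subset V$ and $\kappa(a,b)=\lambda(f(a),f(b))$ for all $a,b\in A$; it is a morphism if $A=V$, an isomorphism if moreover bijective; an automorphism is a self-isomorphism. A GEC is absolutely homogeneous if every partial morphism from it into itself extends to an automorphism. Property $(\ast)$ means: for every vertex $z$ and distinct vertices $x,y$ different from $z$, $\kappa(x,z)\neq\kappa(y,z)$. Two GECs $\mathfrak G_j=(V_j,\kappa_j)$ with pseudocolors $p_j$ ($j=1,2$) are structurally equivalent if there is a bijection $\theta\colon \mathrm{Col}(\mathfrak G_1)\cup\{p_1\}\to\mathrm{Col}(\mathfrak G_2)\cup\{p_2\}$ such that the GECs $(V_1,\theta\circ\kappa_1)$ and $(V_2,\kappa_2)$ are isomorphic; any such $\theta$ is called a structural isotopy. A group $(G,+)$ with neutral element $e$ is Boolean if $a+a=e$ for all $a\in G$ (such a group is Abelian). As a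 GEC, it has vertex set $G$, coloring $(a,b)\mapsto a+b$, palette $G\setminus\{e\}$ and pseudocolor $e$. *)

theory Defs
  imports "HOL-Algebra.Bij"
begin

text \<open>Only the values of \<open>color X\<close> on \<open>verts X \<times> verts X\<close> are relevant; the target set \<open>Y\<close> of the
  coloring is by surjectivity the image of \<open>verts X \<times> verts X\<close>, so it is not recorded separately.\<close>

record ('v, 'c) gec =
  verts :: "'v set"
  color :: "'v \<Rightarrow> 'v \<Rightarrow> 'c"

locale GEC =
  fixes X :: "('v, 'c) gec"
  assumes color_eq_diag_iff:
      "\<lbrakk>x \<in> verts X; y \<in> verts X; z \<in> verts X\<rbrakk> \<Longrightarrow> color X x y = color X z z \<longleftrightarrow> x = y"
    and color_sym: "\<lbrakk>x \<in> verts X; y \<in> verts X\<rbrakk> \<Longrightarrow> color X y x = color X x y"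

definition palette :: "('v, 'c) gec \<Rightarrow> 'c set" where
  "palette X = {color X x y | x y. x \<in> verts X \<and> y \<in> verts X \<and> x \<noteq> y}"

text \<open>Unspecified if there are no vertices.\<close>

definition pseudocolor :: "('v, 'c) gec \<Rightarrow> 'c" where
  "pseudocolor X = (THE p. \<exists>z \<in> verts X. color X z z = p)"

definition partial_morphism ::
    "('v, 'c) gec \<Rightarrow> ('w, 'c) gec \<Rightarrow> 'v set \<Rightarrow> ('v \<Rightarrow> 'w) \<Rightarrow> bool" where
  "partial_morphism X Y A f \<longleftrightarrow>
     A \<subseteq> verts X \<and> f \<in> A \<rightarrow> verts Y \<and> (\<forall>a\<in>A. \<forall>b\<in>A. color X a b = color Y (f a) (f b))"

definition gec_morphism :: "('v, 'c) gec \<Rightarrow> ('w, 'c) gec \<Rightarrow> ('v \<Rightarrow> 'w) \<Rightarrow> bool" where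
  "gec_morphism X Y f \<longleftrightarrow> partial_morphism X Y (verts X) f"

definition gec_isomorphism :: "('v, 'c) gec \<Rightarrow> ('w, 'c) gec \<Rightarrow> ('v \<Rightarrow> 'w) \<Rightarrow> bool" where
  "gec_isomorphism X Y f \<longleftrightarrow> gec_morphism X Y f \<and> bij_betw f (verts X) (verts Y)"

definition gec_isomorphic :: "('v, 'c) gec \<Rightarrow> ('w, 'c) gec \<Rightarrow> bool" where
  "gec_isomorphic X Y \<longleftrightarrow> (\<exists>f. gec_isomorphism X Y f)"

text \<open>Automorphisms are represented by extensional functions, so that equality of automorphisms is
  equality on the vertex set.\<close>

definition gec_AutoGroup :: "('v, 'c) gec \<Rightarrow> ('v \<Rightarrow> 'v) monoid" where
  "gec_AutoGroup X =
     BijGroup (verts X) \<lparr>carrier := {f \<in> extensional (verts X). gec_isomorphism X X f}\<rparr>"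

abbreviation automorphisms :: "('v, 'c) gec \<Rightarrow> ('v \<Rightarrow> 'v) set" where
  "automorphisms X \<equiv> carrier (gec_AutoGroup X)"

definition absolutely_homogeneous :: "('v, 'c) gec \<Rightarrow> bool" where
  "absolutely_homogeneous X \<longleftrightarrow>
     (\<forall>A f. partial_morphism X X A f \<longrightarrow> (\<exists>g \<in> automorphisms X. \<forall>a\<in>A. g a = f a))"

definition unique_extension_property :: "('v, 'c) gec \<Rightarrow> bool" where
  "unique_extension_property X \<longleftrightarrow>
     (\<forall>A f. A \<noteq> {} \<longrightarrow> partial_morphism X X A f \<longrightarrow>
        (\<exists>!g. g \<in> automorphisms X \<and> (\<forall>a\<in>A. g a = f a)))"

definition distinct_colors_at_vertices :: "('v, 'c) gec \<Rightarrow> bool" where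
  "distinct_colors_at_vertices X \<longleftrightarrow>
     (\<forall>z \<in> verts X. \<forall>x \<in> verts X. \<forall>y \<in> verts X.
        x \<noteq> y \<and> x \<noteq> z \<and> y \<noteq> z \<longrightarrow> color X x z \<noteq> color X y z)"

definition recolor :: "('c \<Rightarrow> 'd) \<Rightarrow> ('v, 'c) gec \<Rightarrow> ('v, 'd) gec" where
  "recolor \<theta> X = \<lparr>verts = verts X, color = (\<lambda>x y. \<theta> (color X x y))\<rparr>"

definition structural_isotopy :: "('v, 'c) gec \<Rightarrow> ('w, 'd) gec \<Rightarrow> ('c \<Rightarrow> 'd) \<Rightarrow> bool" where
  "structural_isotopy X Y \<theta> \<longleftrightarrow>
     bij_betw \<theta> (palette X \<union> {pseudocolor X}) (palette Y \<union> {pseudocolor Y}) \<and>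
     gec_isomorphic (recolor \<theta> X) Y"

definition structurally_equivalent :: "('v, 'c) gec \<Rightarrow> ('w, 'd) gec \<Rightarrow> bool" where
  "structurally_equivalent X Y \<longleftrightarrow> (\<exists>\<theta>. structural_isotopy X Y \<theta>)"

locale boolean_group = group G for G (structure) +
  assumes self_inverse: "a \<in> carrier G \<Longrightarrow> a \<otimes> a = \<one>"

definition group_gec :: "('g, 'm) monoid_scheme \<Rightarrow> ('g, 'g) gec" where
  "group_gec G = \<lparr>verts = carrier G, color = (\<lambda>a b. a \<otimes>\<^bsub>G\<^esub> b)\<rparr>"

definition translation :: "('g, 'm) monoid_scheme \<Rightarrow> 'g \<Rightarrow> 'g \<Rightarrow> 'g" where
  "translation G a = (\<lambda>x \<in> carrier G. a \<otimes>\<^bsub>G\<^esub> x)"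

context boolean_group
begin

lemma mult_eq_one_iff:
  assumes "a \<in> carrier G" "b \<in> carrier G"
  shows "a \<otimes> b = \<one> \<longleftrightarrow> a = b"
  using assms by (metis inv_equality inv_inv self_inverse)

lemma pseudocolor_group_gec: "pseudocolor (group_gec G) = \<one>"
  unfolding pseudocolor_def group_gec_def
  by (rule the_equality) (auto simp: self_inverse)

lemma palette_group_gec: "palette (group_gec G) = carrier G - {\<one>}"
proof
  show "palette (group_gec G) \<subseteq> carrier G - {\<one>}"
    by (auto simp: palette_def group_gec_def mult_eq_one_iff)
  show "carrier G - {\<one>} \<subseteq> palette (group_gec G)"
  proof
    fix a assume "a \<in> carrier G - {\<one>}"
    then show "a \<in> palette (group_gec G)"
      unfolding palette_def group_gec_def
      by (intro CollectI exI[where x = a] exI[where x = \<one>]) auto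
  qed
qed

end

end

theory Submission
  imports Defs
begin

text \<open>In a Boolean group every equation \<open>a \<otimes> b = c\<close> can be solved as \<open>a = c \<otimes> b\<close>. If \<open>f\<close> preserves the
  colors, then \<open>f x \<otimes> f u = x \<otimes> u\<close> can therefore be solved for \<open>f x\<close>: one value of \<open>f\<close> determines \<open>f\<close>,
  and \<open>f\<close> is the translation by \<open>f u \<otimes> u\<close>. This gives the description of the partial morphisms and of the
  automorphisms (\<open>partial_morphism_eq_translation\<close>). The same computation applied to
  \<open>\<theta> (x \<otimes> y) = f x \<otimes> f y\<close> gives \<open>f x = \<theta> x \<otimes> f \<one>\<close>, and the two factors \<open>f \<one>\<close> cancel in
  \<open>\<theta> (x \<otimes> y)\<close>; so a structural isotopy is a homomorphism (\<open>structural_isotopy_iff_iso\<close>).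

  For the converse, fix a vertex \<open>e\<close> of an absolutely homogeneous GEC with different colors at each
  vertex. Every vertex is then identified with the color of the edge joining it to \<open>e\<close>. A color preserving
  self-map is determined by its value at one vertex (\<open>morphisms_agree\<close>). By homogeneity, the exchange of
  two vertices \<open>x\<close> and \<open>y\<close> extends to such a map, which is an involution because its square fixes \<open>x\<close>
  (\<open>exchange_extends_to_involution\<close>). Let \<open>T x\<close> be the involution that exchanges \<open>e\<close> and \<open>x\<close>.
  Applying it to the edge \<open>{x, y}\<close> shows that this edge has the color of \<open>{e, T x y}\<close>; so the
  coloring, read as an operation on the vertices, is \<open>(x, y) \<mapsto> T x y\<close>. The operation is associative
  because \<open>T (T x y)\<close> and \<open>T x \<circ> T y\<close> agree at \<open>e\<close>, and the laws of a Boolean group that remain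
  follow at once from the axioms of a GEC (\<open>homogeneous_isomorphic_boolean_group\<close>).

  Finally, unique extension implies both assumptions of this converse: if \<open>{z, x}\<close> and \<open>{z, y}\<close> had the
  same color, then the automorphism extending \<open>z \<mapsto> z, x \<mapsto> y\<close> would fix \<open>z\<close> and hence be the identity.\<close>

section \<open>The coloring of a Boolean group\<close>

context boolean_group
begin

lemma mult_eq_iff:
  assumes "a \<in> carrier G" "b \<in> carrier G" "c \<in> carrier G"
  shows "a \<otimes> b = c \<longleftrightarrow> a = c \<otimes> b"
  using assms by (metis m_assoc r_one self_inverse)

lemma mult_commute:
  assumes "a \<in> carrier G" "b \<in> carrier G"
  shows "a \<otimes> b = b \<otimes> a"
  using assms by (metis inv_equality inv_mult_group m_closed self_inverse)

lemma GEC_group_gec: "GEC (group_gec G)"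
  by unfold_locales (auto simp: group_gec_def self_inverse mult_eq_one_iff mult_commute)

lemma distinct_colors_group_gec: "distinct_colors_at_vertices (group_gec G)"
  by (auto simp: distinct_colors_at_vertices_def group_gec_def)

lemma partial_morphism_eq_translation:
  assumes f: "partial_morphism (group_gec G) (group_gec G) A f" and "u \<in> A" "x \<in> A"
  shows "f x = translation G (f u \<otimes> u) x"
proof -
  have mem: "x \<in> carrier G" "u \<in> carrier G" "f x \<in> carrier G" "f u \<in> carrier G"
    and eq: "x \<otimes> u = f x \<otimes> f u"
    using assms by (auto simp: partial_morphism_def group_gec_def)
  have "f x = (x \<otimes> u) \<otimes> f u"
    using mem eq mult_eq_iff by (metis m_closed)
  also have "\<dots> = (f u \<otimes> u) \<otimes> x"
    using mem by (metis m_assoc m_closed mult_commute)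
  finally show ?thesis
    using mem by (simp add: translation_def)
qed

lemma translation_automorphism:
  assumes "a \<in> carrier G"
  shows "translation G a \<in> automorphisms (group_gec G)"
proof -
  have color: "x \<otimes> y = (a \<otimes> x) \<otimes> (a \<otimes> y)" if "x \<in> carrier G" "y \<in> carrier G" for x y
  proof -
    have "(a \<otimes> x) \<otimes> (a \<otimes> y) = (x \<otimes> a) \<otimes> (a \<otimes> y)"
      using that assms by (simp add: mult_commute)
    also have "\<dots> = x \<otimes> ((a \<otimes> a) \<otimes> y)"
      using that assms by (simp add: m_assoc)
    finally show ?thesis
      using that assms by (simp add: self_inverse)
  qed
  have "bij_betw (translation G a) (carrier G) (carrier G)"
    by (rule bij_betw_byWitness[where f' = "translation G a"])
      (use assms in \<open>auto simp: translation_def self_inverse simp flip: m_assoc\<close>)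
  moreover have "partial_morphism (group_gec G) (group_gec G) (carrier G) (translation G a)"
    unfolding partial_morphism_def using assms color[symmetric]
    by (simp add: group_gec_def translation_def)
  moreover have "translation G a \<in> extensional (carrier G)"
    by (simp add: translation_def)
  ultimately show ?thesis
    by (simp add: gec_AutoGroup_def gec_isomorphism_def gec_morphism_def group_gec_def)
qed

lemma automorphisms_group_gec:
  "automorphisms (group_gec G) = translation G ` carrier G"
proof
  show "automorphisms (group_gec G) \<subseteq> translation G ` carrier G"
  proof
    fix f assume "f \<in> automorphisms (group_gec G)"
    then have ext: "f \<in> extensional (carrier G)"
      and f: "partial_morphism (group_gec G) (group_gec G) (carrier G) f"
      by (auto simp: gec_AutoGroup_def gec_isomorphism_def gec_morphism_def group_gec_def)
    have "f = translation G (f \<one> \<otimes> \<one>)"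
    proof (rule extensionalityI[OF ext])
      show "translation G (f \<one> \<otimes> \<one>) \<in> extensional (carrier G)"
        by (simp add: translation_def)
    qed (rule partial_morphism_eq_translation[OF f one_closed])
    moreover have "f \<one> \<otimes> \<one> \<in> carrier G"
      using f by (auto simp: partial_morphism_def group_gec_def)
    ultimately show "f \<in> translation G ` carrier G" by blast
  qed
qed (auto intro: translation_automorphism)

lemma unique_extension_group_gec: "unique_extension_property (group_gec G)"
  unfolding unique_extension_property_def
proof (intro allI impI)
  fix A f
  assume "A \<noteq> {}" and f: "partial_morphism (group_gec G) (group_gec G) A f"
  then obtain u where u: "u \<in> A" by blast
  then have mem: "u \<in> carrier G" "f u \<in> carrier G"
    using f by (auto simp: partial_morphism_def group_gec_def)
  show "\<exists>!g. g \<in> automorphisms (group_gec G) \<and> (\<forall>a\<in>A. g a = f a)"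
  proof (rule ex1I[of _ "translation G (f u \<otimes> u)"])
    show "translation G (f u \<otimes> u) \<in> automorphisms (group_gec G) \<and>
        (\<forall>a\<in>A. translation G (f u \<otimes> u) a = f a)"
      using mem translation_automorphism partial_morphism_eq_translation[OF f u, symmetric]
      by simp
  next
    fix g assume g: "g \<in> automorphisms (group_gec G) \<and> (\<forall>a\<in>A. g a = f a)"
    then obtain b where b: "b \<in> carrier G" "g = translation G b"
      by (auto simp: automorphisms_group_gec)
    then have "b \<otimes> u = f u" using g u mem by (auto simp: translation_def)
    then show "g = translation G (f u \<otimes> u)" using b mem mult_eq_iff by simp
  qed
qed

end

section \<open>Structural isotopies of Boolean groups\<close>

lemma structural_isotopy_iff_iso:
  assumes "boolean_group G" "boolean_group H"
  shows "structural_isotopy (group_gec G) (group_gec H) \<theta> \<longleftrightarrow> \<theta> \<in> iso G H"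
proof -
  interpret G: boolean_group G by fact
  interpret H: boolean_group H by fact
  have colors: "palette (group_gec G) \<union> {pseudocolor (group_gec G)} = carrier G"
    "palette (group_gec H) \<union> {pseudocolor (group_gec H)} = carrier H"
    by (auto simp: G.palette_group_gec G.pseudocolor_group_gec
        H.palette_group_gec H.pseudocolor_group_gec)
  show ?thesis
  proof
    assume iso: "structural_isotopy (group_gec G) (group_gec H) \<theta>"
    then have bij: "bij_betw \<theta> (carrier G) (carrier H)"
      unfolding structural_isotopy_def colors by simp
    from iso obtain f where f: "f \<in> carrier G \<rightarrow> carrier H"
      and eq: "\<And>a b. a \<in> carrier G \<Longrightarrow> b \<in> carrier G \<Longrightarrow> \<theta> (a \<otimes>\<^bsub>G\<^esub> b) = f a \<otimes>\<^bsub>H\<^esub> f b"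
      by (auto simp: structural_isotopy_def gec_isomorphic_def gec_isomorphism_def gec_morphism_def
          partial_morphism_def recolor_def group_gec_def)
    have one: "f \<one>\<^bsub>G\<^esub> \<in> carrier H" using f by auto
    have theta: "\<theta> a = f a \<otimes>\<^bsub>H\<^esub> f \<one>\<^bsub>G\<^esub>" if "a \<in> carrier G" for a
      using eq[OF that G.one_closed] that by simp
    have "\<theta> (a \<otimes>\<^bsub>G\<^esub> b) = \<theta> a \<otimes>\<^bsub>H\<^esub> \<theta> b" if ab: "a \<in> carrier G" "b \<in> carrier G" for a b
    proof -
      have fab: "f a \<in> carrier H" "f b \<in> carrier H" using ab f by auto
      have "\<theta> a \<otimes>\<^bsub>H\<^esub> \<theta> b = (f a \<otimes>\<^bsub>H\<^esub> f \<one>\<^bsub>G\<^esub>) \<otimes>\<^bsub>H\<^esub> (f \<one>\<^bsub>G\<^esub> \<otimes>\<^bsub>H\<^esub> f b)"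
        using ab fab one by (simp add: theta H.mult_commute)
      also have "\<dots> = f a \<otimes>\<^bsub>H\<^esub> ((f \<one>\<^bsub>G\<^esub> \<otimes>\<^bsub>H\<^esub> f \<one>\<^bsub>G\<^esub>) \<otimes>\<^bsub>H\<^esub> f b)"
        using fab one by (simp add: H.m_assoc)
      also have "\<dots> = f a \<otimes>\<^bsub>H\<^esub> f b"
        using fab one by (simp add: H.self_inverse)
      finally show ?thesis using ab eq by simp
    qed
    with bij show "\<theta> \<in> iso G H"
      by (auto simp: iso_def hom_def dest: bij_betwE)
  next
    assume iso: "\<theta> \<in> iso G H"
    \<comment> \<open>A group isomorphism, used as a recoloring, is matched by itself as a map of vertices.\<close>
    have "gec_isomorphism (recolor \<theta> (group_gec G)) (group_gec H) \<theta>"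
      using iso by (auto simp: gec_isomorphism_def gec_morphism_def partial_morphism_def recolor_def
          group_gec_def iso_def hom_def)
    with iso show "structural_isotopy (group_gec G) (group_gec H) \<theta>"
      unfolding structural_isotopy_def colors by (auto simp: gec_isomorphic_def iso_def)
  qed
qed

section \<open>Homogeneous GECs as Boolean groups\<close>

context GEC
begin

text \<open>The axioms of a GEC exclude that one of the two edges is degenerate and the other is not; so
  different colors at the vertices give injectivity without the restriction to edges.\<close>

lemma color_inject:
  assumes "distinct_colors_at_vertices X" "x \<in> verts X" "y \<in> verts X" "z \<in> verts X"
    and "color X z x = color X z y"
  shows "x = y"
  using assms unfolding distinct_colors_at_vertices_def by (metis color_eq_diag_iff color_sym)

lemma morphisms_agree:
  assumes "distinct_colors_at_vertices X" "gec_morphism X X g" "gec_morphism X X h"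
    and "z \<in> verts X" "g z = h z" "x \<in> verts X"
  shows "g x = h x"
proof (rule color_inject[of _ _ "g z"])
  have color: "color X (k z) (k x) = color X z x" if "gec_morphism X X k" for k
    using that assms(4,6) by (simp add: gec_morphism_def partial_morphism_def)
  show "color X (g z) (g x) = color X (g z) (h x)"
    using color[OF assms(2)] color[OF assms(3)] assms(5) by simp
qed (use assms in \<open>auto simp: gec_morphism_def partial_morphism_def\<close>)

lemma morphism_comp:
  "gec_morphism X X g \<Longrightarrow> gec_morphism X X h \<Longrightarrow> gec_morphism X X (g \<circ> h)"
  by (auto simp: gec_morphism_def partial_morphism_def Pi_iff)

lemma exchange_extends_to_involution:
  assumes hom: "absolutely_homogeneous X" and dist: "distinct_colors_at_vertices X"
    and xy: "x \<in> verts X" "y \<in> verts X"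
  obtains g where "gec_morphism X X g" "g x = y" "\<And>z. z \<in> verts X \<Longrightarrow> g (g z) = z"
proof -
  define s where "s = (\<lambda>z. if z = x then y else x)"
  have "color X x x = color X y y" using xy color_eq_diag_iff by metis
  moreover have "color X x y = color X y x" using xy color_sym by metis
  moreover have s: "s x = y" "s y = x" by (simp_all add: s_def)
  ultimately have "partial_morphism X X {x, y} s"
    using xy by (simp add: partial_morphism_def)
  then obtain g where "g \<in> automorphisms X" "\<forall>a\<in>{x, y}. g a = s a"
    using hom unfolding absolutely_homogeneous_def by blast
  then have g: "gec_morphism X X g" "g x = y" "g y = x"
    by (auto simp: gec_AutoGroup_def gec_isomorphism_def s)
  have "gec_morphism X X id"
    by (simp add: gec_morphism_def partial_morphism_def)
  then have "g (g z) = z" if "z \<in> verts X" for z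
    using morphisms_agree[OF dist morphism_comp[OF g(1) g(1)], of id x z] xy g that by simp
  with g show thesis using that by blast
qed

theorem homogeneous_isomorphic_boolean_group:
  assumes ne: "verts X \<noteq> {}" and hom: "absolutely_homogeneous X"
    and dist: "distinct_colors_at_vertices X"
  shows "\<exists>B :: 'c monoid. boolean_group B \<and> gec_isomorphic X (group_gec B)"
proof -
  let ?V = "verts X"
  obtain e where e: "e \<in> ?V" using ne by blast
  have "\<exists>g. gec_morphism X X g \<and> g e = x \<and> (\<forall>z\<in>?V. g (g z) = z)" if "x \<in> ?V" for x
    using exchange_extends_to_involution[OF hom dist e that] by metis
  then obtain T where T: "\<And>x. x \<in> ?V \<Longrightarrow> gec_morphism X X (T x)"
    and T_base: "\<And>x. x \<in> ?V \<Longrightarrow> T x e = x"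
    and T_inv: "\<And>x z. x \<in> ?V \<Longrightarrow> z \<in> ?V \<Longrightarrow> T x (T x z) = z"
    by metis
  have T_closed: "T x y \<in> ?V" if "x \<in> ?V" "y \<in> ?V" for x y
    using T[OF that(1)] that by (auto simp: gec_morphism_def partial_morphism_def)
  have T_color: "color X (T x y) (T x z) = color X y z" if "x \<in> ?V" "y \<in> ?V" "z \<in> ?V" for x y z
    using T[OF that(1)] that by (auto simp: gec_morphism_def partial_morphism_def)
  \<comment> \<open>Apply \<open>T x\<close>, which exchanges \<open>e\<close> and \<open>x\<close>, to the edge from \<open>x\<close> to \<open>y\<close>.\<close>
  have color_T: "color X x y = color X e (T x y)" if "x \<in> ?V" "y \<in> ?V" for x y
    using T_color[of x e "T x y"] T_closed T_base T_inv that e by simp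
  have T_assoc: "T (T x y) z = T x (T y z)" if "x \<in> ?V" "y \<in> ?V" "z \<in> ?V" for x y z
    using morphisms_agree[OF dist T morphism_comp[OF T T], of "T x y" x y e z]
      T_closed T_base that e by simp

  define c where "c = color X e"
  define v where "v = inv_into ?V c"
  have inj: "inj_on c ?V"
    using color_inject[OF dist _ _ e] by (auto simp: inj_on_def c_def)
  then have v_c: "v (c x) = x" if "x \<in> ?V" for x
    using that by (simp add: v_def)
  \<comment> \<open>The operation \<open>T\<close>, carried over to colors by the injection \<open>c\<close>.\<close>
  define B :: "'c monoid" where
    "B = \<lparr>carrier = c ` ?V, mult = (\<lambda>p q. color X (v p) (v q)), one = c e\<rparr>"
  have mult: "c x \<otimes>\<^bsub>B\<^esub> c y = color X x y" if "x \<in> ?V" "y \<in> ?V" for x y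
    using that by (simp add: B_def v_c)
  have mult_T: "c x \<otimes>\<^bsub>B\<^esub> c y = c (T x y)" if "x \<in> ?V" "y \<in> ?V" for x y
    using mult[OF that] color_T[OF that] by (simp add: c_def)
  have B_carrier: "carrier B = c ` ?V" and B_one: "\<one>\<^bsub>B\<^esub> = c e" by (simp_all add: B_def)
  have left_one: "\<one>\<^bsub>B\<^esub> \<otimes>\<^bsub>B\<^esub> p = p" if "p \<in> carrier B" for p
    using that mult e by (auto simp: B_carrier B_one c_def)
  have square: "p \<otimes>\<^bsub>B\<^esub> p = \<one>\<^bsub>B\<^esub>" if "p \<in> carrier B" for p
  proof -
    obtain x where x: "x \<in> ?V" "p = c x" using \<open>p \<in> carrier B\<close> unfolding B_carrier by blast
    then have "p \<otimes>\<^bsub>B\<^esub> p = color X x x" by (simp add: mult)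
    also have "\<dots> = c e" using x e by (simp add: c_def color_eq_diag_iff)
    finally show ?thesis by (simp add: B_one)
  qed
  have "group B"
  proof (rule groupI)
    show "p \<otimes>\<^bsub>B\<^esub> q \<in> carrier B" if "p \<in> carrier B" "q \<in> carrier B" for p q
      using that by (auto simp: B_carrier mult_T T_closed)
    show "p \<otimes>\<^bsub>B\<^esub> q \<otimes>\<^bsub>B\<^esub> r = p \<otimes>\<^bsub>B\<^esub> (q \<otimes>\<^bsub>B\<^esub> r)"
      if "p \<in> carrier B" "q \<in> carrier B" "r \<in> carrier B" for p q r
      using that by (auto simp: B_carrier mult_T T_closed T_assoc)
    show "\<one>\<^bsub>B\<^esub> \<in> carrier B" using e by (simp add: B_carrier B_one)
  qed (use left_one square in auto)
  with square have "boolean_group B"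
    by (simp add: boolean_group_def boolean_group_axioms_def)
  moreover have "gec_isomorphism X (group_gec B) c"
    using inj mult by (auto simp: gec_isomorphism_def gec_morphism_def partial_morphism_def
        group_gec_def B_carrier bij_betw_def)
  ultimately show ?thesis
    unfolding gec_isomorphic_def by blast
qed

lemma unique_extensionD:
  assumes "unique_extension_property X" "partial_morphism X X A f" "A \<noteq> {}"
  shows "\<exists>!g. g \<in> automorphisms X \<and> (\<forall>a\<in>A. g a = f a)"
  using assms unfolding unique_extension_property_def by simp

lemma identity_automorphism: "restrict id (verts X) \<in> automorphisms X"
  by (auto simp: gec_AutoGroup_def gec_isomorphism_def gec_morphism_def partial_morphism_def
      bij_betw_def inj_on_def)

text \<open>Only the empty partial morphism is not covered by unique extension, and the identity extends it.\<close>

lemma unique_extension_imp_homogeneous: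
  assumes "unique_extension_property X"
  shows "absolutely_homogeneous X"
  unfolding absolutely_homogeneous_def
proof (intro allI impI)
  fix A f assume f: "partial_morphism X X A f"
  show "\<exists>g\<in>automorphisms X. \<forall>a\<in>A. g a = f a"
  proof (cases "A = {}")
    case True
    then show ?thesis using identity_automorphism by blast
  next
    case False
    then have "\<exists>!g. g \<in> automorphisms X \<and> (\<forall>a\<in>A. g a = f a)"
      by (rule unique_extensionD[OF assms f])
    then show ?thesis by (auto dest: ex1_implies_ex)
  qed
qed

lemma unique_extension_imp_distinct_colors:
  assumes "unique_extension_property X"
  shows "distinct_colors_at_vertices X"
  unfolding distinct_colors_at_vertices_def
proof (intro ballI impI notI)
  fix z x y
  assume V: "z \<in> verts X" "x \<in> verts X" "y \<in> verts X"
    and ne: "x \<noteq> y \<and> x \<noteq> z \<and> y \<noteq> z" and eq: "color X x z = color X y z"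
  define f where "f = (\<lambda>a. if a = x then y else a)"
  have "color X x x = color X y y" using V color_eq_diag_iff by metis
  moreover have "color X z x = color X z y" using V eq color_sym by metis
  ultimately have "partial_morphism X X {z, x} f"
    using V ne eq by (auto simp: partial_morphism_def f_def)
  then have "\<exists>!g. g \<in> automorphisms X \<and> (\<forall>a\<in>{z, x}. g a = f a)"
    by (rule unique_extensionD[OF assms]) simp
  then obtain g where "g \<in> automorphisms X" "\<forall>a\<in>{z, x}. g a = f a" by (elim ex1E) blast
  then have g: "g \<in> automorphisms X" "g z = z" "g x = y" using ne by (auto simp: f_def)
  \<comment> \<open>Both \<open>g\<close> and the identity extend the inclusion of the single vertex \<open>z\<close>.\<close>
  have "partial_morphism X X {z} id" using V by (simp add: partial_morphism_def)
  then have "\<exists>!h. h \<in> automorphisms X \<and> (\<forall>a\<in>{z}. h a = id a)"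
    by (rule unique_extensionD[OF assms]) simp
  moreover have "\<forall>a\<in>{z}. restrict id (verts X) a = id a" "\<forall>a\<in>{z}. g a = id a"
    using V g by simp_all
  ultimately have "g = restrict id (verts X)"
    using identity_automorphism g by blast
  then show False using g ne V by simp
qed

end

theorem theorem3p27:
  "(\<forall>G :: 'g monoid. boolean_group G \<longrightarrow>
      GEC (group_gec G) \<and>
      absolutely_homogeneous (group_gec G) \<and>
      distinct_colors_at_vertices (group_gec G) \<and>
      automorphisms (group_gec G) = translation G ` carrier G \<and>
      unique_extension_property (group_gec G)) \<and>
   (\<forall>(G :: 'g\<^sub>1 monoid) (H :: 'g\<^sub>2 monoid). boolean_group G \<longrightarrow> boolean_group H \<longrightarrow>
      (structurally_equivalent (group_gec G) (group_gec H) \<longleftrightarrow> G \<cong> H) \<and>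
      {\<theta>. structural_isotopy (group_gec G) (group_gec H) \<theta>} = iso G H) \<and>
   (\<forall>X :: ('v, 'c) gec. GEC X \<longrightarrow> verts X \<noteq> {} \<longrightarrow> unique_extension_property X \<longrightarrow>
      (\<exists>B :: 'c monoid. boolean_group B \<and> gec_isomorphic X (group_gec B))) \<and>
   (\<forall>X :: ('v, 'c) gec. GEC X \<longrightarrow> verts X \<noteq> {} \<longrightarrow> absolutely_homogeneous X \<longrightarrow>
      distinct_colors_at_vertices X \<longrightarrow>
      (\<exists>B :: 'c monoid. boolean_group B \<and> gec_isomorphic X (group_gec B)))"
proof (intro conjI allI impI)
  fix G :: "'g monoid"
  assume "boolean_group G"
  then interpret boolean_group G .
  show "GEC (group_gec G)" by (rule GEC_group_gec)
  show "distinct_colors_at_vertices (group_gec G)" by (rule distinct_colors_group_gec)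
  show "automorphisms (group_gec G) = translation G ` carrier G" by (rule automorphisms_group_gec)
  show "unique_extension_property (group_gec G)" by (rule unique_extension_group_gec)
  then show "absolutely_homogeneous (group_gec G)"
    by (rule GEC.unique_extension_imp_homogeneous[OF GEC_group_gec])
next
  fix G :: "'g\<^sub>1 monoid" and H :: "'g\<^sub>2 monoid"
  assume "boolean_group G" "boolean_group H"
  note isotopy = structural_isotopy_iff_iso[OF this]
  show "structurally_equivalent (group_gec G) (group_gec H) \<longleftrightarrow> G \<cong> H"
    by (auto simp: structurally_equivalent_def is_iso_def isotopy)
  show "{\<theta>. structural_isotopy (group_gec G) (group_gec H) \<theta>} = iso G H"
    by (simp add: isotopy)
next
  fix X :: "('v, 'c) gec"
  assume "GEC X" and X: "verts X \<noteq> {}" "unique_extension_property X"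
  then interpret GEC X by simp
  show "\<exists>B :: 'c monoid. boolean_group B \<and> gec_isomorphic X (group_gec B)"
    using X homogeneous_isomorphic_boolean_group unique_extension_imp_homogeneous
      unique_extension_imp_distinct_colors by blast
next
  fix X :: "('v, 'c) gec"
  assume "GEC X" "verts X \<noteq> {}" "absolutely_homogeneous X" "distinct_colors_at_vertices X"
  then show "\<exists>B :: 'c monoid. boolean_group B \<and> gec_isomorphic X (group_gec B)"
    by (rule GEC.homogeneous_isomorphic_boolean_group)
qed

end
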